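(* Let $T=\{2143,3142,3412\}$ and let $F_T(x)=\sum_{n\ge0}|S_n(T)|x^n$. Then $$F_T(x)=\frac{(1-3x)C(x)}{1-2x-x(1-x)C(x)},$$ where $C(x)=\frac{1-\sqrt{1-4x}}{2x}$.
   Context: $S_n$ is the set of permutations of $[n]$ ($S_0$ contains the empty permutation). A permutation avoids a pattern $\tau$ if it has no subsequence order-isomorphic to $\tau$; $S_n(T)$ is the set of permutations in $S_n$ avoiding every pattern in $T$. $C(x)$ is the Catalan generating function. *)

theory Defs
  imports Complex_Main
    "HOL-Library.Sublist"
    "HOL-Combinatorics.Multiset_Permutations"
    "HOL-Computational_Algebra.Formal_Power_Series"
begin

text \<open>
  A permutation of \<open>[n]\<close> is written in one-line notation, as a list that contains each of
  \<open>1, \<dots>, n\<close> exactly once; patterns are lists of the same kind.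
\<close>

definition order_isomorphic :: "nat list \<Rightarrow> nat list \<Rightarrow> bool" where
  "order_isomorphic xs ys \<longleftrightarrow>
     length xs = length ys \<and>
     (\<forall>i<length xs. \<forall>j<length xs. xs ! i < xs ! j \<longleftrightarrow> ys ! i < ys ! j)"

text \<open>Here \<^const>\<open>subseq\<close> is the not necessarily contiguous sublist relation.\<close>

definition avoids :: "nat list \<Rightarrow> nat list \<Rightarrow> bool" where
  "avoids \<pi> \<tau> \<longleftrightarrow> \<not> (\<exists>\<sigma>. subseq \<sigma> \<pi> \<and> order_isomorphic \<sigma> \<tau>)"

definition Sn_avoiding :: "nat \<Rightarrow> nat list set \<Rightarrow> nat list set" where
  "Sn_avoiding n T = {\<pi> \<in> permutations_of_set {1..n}. \<forall>\<tau>\<in>T. avoids \<pi> \<tau>}"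

definition avoiding_gf :: "nat list set \<Rightarrow> real fps" where
  "avoiding_gf T = Abs_fps (\<lambda>n. real (card (Sn_avoiding n T)))"

text \<open>
  \<^term>\<open>fps_radical root 2 (1 - 4 * fps_X)\<close> is the formal square root of \<open>1 - 4x\<close> with constant
  coefficient \<open>1\<close>. The divisor \<open>2x\<close> is not a unit among the formal power series, but the numerator
  is a multiple of \<open>x\<close>, so that the division is exact.
\<close>

definition catalan_gf :: "real fps" where
  "catalan_gf = (1 - fps_radical root 2 (1 - 4 * fps_X)) / (2 * fps_X)"

end

theory Submission
  imports Defs
begin

text \<open>
  Write an avoider of length \<open>n \<ge> 1\<close> as \<open>L n R\<close> and let \<open>A(x)\<close> be the generating function sought.

  If \<open>L\<close> contains a descent, then every entry of \<open>R\<close> lies below every inversion of \<open>L\<close>, and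
  \<open>R\<close> decreases. Hence the entry 1 comes first, or comes last, or else \<open>R\<close> is empty; the
  generating function \<open>B\<close> of this case satisfies \<open>B = 2xB + x(A - 1 - xA)\<close>.

  If \<open>L\<close> increases and has length \<open>u > 0\<close> and last entry \<open>m\<close>, then \<open>L n R\<close> avoids the patterns iff
  \<open>m R\<close> does and the \<open>t\<close> entries of \<open>R\<close> below \<open>m\<close> decrease. A rotation by 90 degrees preserves the
  set of patterns and turns \<open>m R\<close> into a permutation whose maximum follows an increasing run of
  length \<open>t\<close>. So the generating functions \<open>g\<^sub>u(x)\<close>, where \<open>x\<close> marks the entries of \<open>R\<close>, satisfy
  \<open>g\<^sub>u = \<Sum>\<^sub>t (u + t - 1 choose t) x\<^sup>t g\<^sub>t\<close> and \<open>g\<^sub>0 = A\<close>. As \<open>1 / (1 - xC) = C\<close>, the solution is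
  \<open>g\<^sub>u = A C\<^sup>u\<close>, and \<open>A = 1 + B + x \<Sum>\<^sub>u x\<^sup>u g\<^sub>u = 1 + B + xAC\<close>.
\<close>

subsection \<open>Forbidden subsequences\<close>

text \<open>The disjuncts are the patterns 2143, 3142 and 3412, in this order.\<close>

definition forbidden :: "nat \<Rightarrow> nat \<Rightarrow> nat \<Rightarrow> nat \<Rightarrow> bool" where
  "forbidden a b c d \<longleftrightarrow>
     b < a \<and> a < d \<and> d < c \<or> b < d \<and> d < a \<and> a < c \<or> c < d \<and> d < a \<and> a < b"

definition good :: "nat list \<Rightarrow> bool" where
  "good xs \<longleftrightarrow> (\<forall>a b c d. subseq [a, b, c, d] xs \<longrightarrow> \<not> forbidden a b c d)"

text \<open>Arbitrary value sets are allowed because deleting or contracting entries leaves gaps in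
  the values; \<open>rank\<close> closes them later.\<close>

definition Av :: "nat set \<Rightarrow> nat list set" where
  "Av S = {xs \<in> permutations_of_set S. good xs}"

text \<open>A sequence order-isomorphic to a pattern has the length of that pattern, so only
  subsequences with four entries matter.\<close>

lemma avoids_length4_iff:
  assumes "length \<tau> = 4"
  shows "avoids \<pi> \<tau> \<longleftrightarrow>
    (\<forall>a b c d. subseq [a, b, c, d] \<pi> \<longrightarrow> \<not> order_isomorphic [a, b, c, d] \<tau>)"
proof -
  have "\<exists>a b c d. \<sigma> = [a, b, c, d]" if "order_isomorphic \<sigma> \<tau>" for \<sigma>
    using that assms by (auto simp: order_isomorphic_def numeral_eq_Suc length_Suc_conv)
  then show ?thesis
    unfolding avoids_def by blast
qed

lemma Sn_avoiding_eq_Av: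
  "Sn_avoiding n {[2, 1, 4, 3], [3, 1, 4, 2], [3, 4, 1, 2]} = Av {1..n}"
proof -
  have "order_isomorphic [a, b, c, d] [2, 1, 4, 3] \<longleftrightarrow> b < a \<and> a < d \<and> d < c"
    "order_isomorphic [a, b, c, d] [3, 1, 4, 2] \<longleftrightarrow> b < d \<and> d < a \<and> a < c"
    "order_isomorphic [a, b, c, d] [3, 4, 1, 2] \<longleftrightarrow> c < d \<and> d < a \<and> a < b" for a b c d
    by (auto simp: order_isomorphic_def All_less_Suc)
  then have "(\<forall>\<tau>\<in>{[2, 1, 4, 3], [3, 1, 4, 2], [3, 4, 1, 2]}. avoids \<pi> \<tau>) \<longleftrightarrow> good \<pi>" for \<pi>
    by (simp add: avoids_length4_iff good_def forbidden_def) blast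
  then show ?thesis
    unfolding Sn_avoiding_def Av_def by blast
qed

lemma Av_iff: "xs \<in> Av S \<longleftrightarrow> set xs = S \<and> distinct xs \<and> good xs"
  by (auto simp: Av_def permutations_of_set_def)

lemma finite_Av [simp]: "finite (Av S)"
  by (simp add: Av_def)

lemma good_subseq: "good ys \<Longrightarrow> subseq xs ys \<Longrightarrow> good xs"
  unfolding good_def by (blast intro: subseq_order.trans[of _ xs ys])

lemma subseq4_snoc_iff:
  "subseq [a, b, c, d] (xs @ [x]) \<longleftrightarrow> subseq [a, b, c, d] xs \<or> d = x \<and> subseq [a, b, c] xs"
proof -
  have "subseq zs [x] \<longleftrightarrow> zs = [] \<or> zs = [x]" for zs
    by (cases zs) auto
  moreover have "[a, b, c, d] = ys @ [x] \<longleftrightarrow> d = x \<and> ys = [a, b, c]" for ys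
    by (auto simp: Cons_eq_append_conv)
  ultimately show ?thesis
    unfolding subseq_append_iff by (metis append_Nil2)
qed

lemma good_Cons_iff:
  "good (x # xs) \<longleftrightarrow> good xs \<and> (\<forall>b c d. subseq [b, c, d] xs \<longrightarrow> \<not> forbidden x b c d)"
proof -
  have "subseq [a, b, c, d] (x # xs) \<longleftrightarrow> subseq [a, b, c, d] xs \<or> a = x \<and> subseq [b, c, d] xs"
    for a b c d
    using subseq_Cons'[of a "[b, c, d]" xs] by auto
  then show ?thesis
    unfolding good_def by blast
qed

lemma good_snoc_iff:
  "good (xs @ [x]) \<longleftrightarrow> good xs \<and> (\<forall>a b c. subseq [a, b, c] xs \<longrightarrow> \<not> forbidden a b c x)"
  unfolding good_def subseq4_snoc_iff by blast

lemma subseq_set: "subseq xs ys \<Longrightarrow> set xs \<subseteq> set ys"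
  by (auto simp: subseq_conv_nths dest: in_set_nthsD)

text \<open>None of the three patterns starts with its least entry, so a new minimum in front takes
  part in no occurrence. The next three lemmas rest on the same remark: no pattern starts with its
  greatest entry, and none ends with its least or its greatest.\<close>

lemma good_Cons_min:
  assumes "\<forall>x\<in>set xs. m < x"
  shows "good (m # xs) \<longleftrightarrow> good xs"
proof -
  have "\<not> forbidden m b c d" if "subseq [b, c, d] xs" for b c d
    using subseq_set[OF that] assms by (auto simp: forbidden_def)
  then show ?thesis by (auto simp: good_Cons_iff)
qed

lemma good_Cons_max:
  assumes "\<forall>x\<in>set xs. x < M"
  shows "good (M # xs) \<longleftrightarrow> good xs"
proof -
  have "\<not> forbidden M b c d" if "subseq [b, c, d] xs" for b c d
    using subseq_set[OF that] assms by (auto simp: forbidden_def)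
  then show ?thesis by (auto simp: good_Cons_iff)
qed

lemma good_snoc_min:
  assumes "\<forall>x\<in>set xs. m < x"
  shows "good (xs @ [m]) \<longleftrightarrow> good xs"
proof -
  have "\<not> forbidden a b c m" if "subseq [a, b, c] xs" for a b c
    using subseq_set[OF that] assms by (auto simp: forbidden_def)
  then show ?thesis by (auto simp: good_snoc_iff)
qed

lemma good_snoc_max:
  assumes "\<forall>x\<in>set xs. x < M"
  shows "good (xs @ [M]) \<longleftrightarrow> good xs"
proof -
  have "\<not> forbidden a b c M" if "subseq [a, b, c] xs" for a b c
    using subseq_set[OF that] assms by (auto simp: forbidden_def)
  then show ?thesis by (auto simp: good_snoc_iff)
qed

lemma sorted_wrt_iff_subseq: "sorted_wrt P xs \<longleftrightarrow> (\<forall>a b. subseq [a, b] xs \<longrightarrow> P a b)"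
proof (induction xs)
  case (Cons x xs)
  have "subseq [a, b] (x # xs) \<longleftrightarrow> subseq [a, b] xs \<or> a = x \<and> b \<in> set xs" for a b
    using subseq_Cons'[of a "[b]" xs] by (auto simp: subseq_singleton_left)
  then show ?case
    using Cons by auto
qed simp

text \<open>The case of four entries in \<open>xs\<close> is absorbed by that of three: each pattern
  has its second or third entry below the first, which an increasing \<open>xs\<close> already rules
  out.\<close>

lemma subseq4_append:
  assumes "subseq [a, b, c, d] (xs @ ys)"
  shows "subseq [a, b, c] xs \<or> subseq [a, b] xs \<and> subseq [c, d] ys \<or>
    a \<in> set xs \<and> subseq [b, c, d] ys \<or> subseq [a, b, c, d] ys"
proof -
  have "subseq [a, b, c] xs" if "subseq [a, b, c, d] xs"
    using that subseq_order.trans[of "[a, b, c]" "[a, b, c, d]" xs] by simp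
  then show ?thesis
    using assms unfolding subseq_append_iff
    by (auto simp: Cons_eq_append_conv subseq_singleton_left)
qed

text \<open>If the entries before the maximum \<open>M\<close> increase, only the last of them matters.\<close>

lemma good_increasing_max_iff:
  assumes L: "sorted_wrt (<) L" "L \<noteq> []" and "distinct (L @ M # R)"
    and M: "\<forall>x\<in>set L \<union> set R. x < M"
  shows "good (L @ M # R) \<longleftrightarrow> good (last L # R) \<and> sorted_wrt (>) (filter (\<lambda>x. x < last L) R)"
    (is "_ \<longleftrightarrow> good (?m # R) \<and> sorted_wrt _ ?F")
proof
  assume good: "good (L @ M # R)"
  have sub: "subseq (?m # R) (L @ M # R)"
    using list_emb_append_mono[of "(=)" "[?m]" L R "M # R"] L
      list_emb_Cons[OF subseq_order.refl[of R]] by (simp add: subseq_singleton_left)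
  \<comment> \<open>An ascent of \<open>R\<close> below \<open>?m\<close>, preceded by
    \<open>?m\<close> and \<open>M\<close>, would be a 3412.\<close>
  have "c > d" if cd: "subseq [c, d] ?F" for c d
  proof (rule ccontr)
    assume "\<not> c > d"
    have cdR: "subseq [c, d] R" using subseq_order.trans[OF cd subseq_filter_left] .
    have "distinct [c, d]" using cdR assms(3) subseq_conv_nths[of "[c, d]" R] distinct_nthsI[of R]
      by (metis distinct.simps(2) distinct_append)
    moreover have "c < ?m" "d < ?m" using subseq_set[OF cd] by auto
    moreover have "?m < M" using M L by simp
    ultimately have "forbidden ?m M c d" using \<open>\<not> c > d\<close> by (auto simp: forbidden_def)
    moreover have "subseq [?m, M, c, d] (L @ M # R)"
      using list_emb_append_mono[of "(=)" "[?m]" L "[M, c, d]" "M # R"] cdR L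
      by (simp add: subseq_singleton_left)
    ultimately show False using good unfolding good_def by blast
  qed
  then show "good (?m # R) \<and> sorted_wrt (>) ?F"
    using good_subseq[OF good sub] sorted_wrt_iff_subseq[of "(>)" ?F] by blast
next
  assume R: "good (?m # R) \<and> sorted_wrt (>) ?F"
  have low: False if "subseq [c, d] R" "c < d" "d < ?m" for c d
  proof -
    have "subseq [c, d] ?F"
      using subseq_filter[OF that(1), of "\<lambda>x. x < ?m"] that by simp
    then have "d < c" using R sorted_wrt_iff_subseq[of "(>)" ?F] by blast
    with \<open>c < d\<close> show False by simp
  qed
  have le: "a \<le> ?m" if "a \<in> set L" for a
    using that L by (cases L rule: rev_cases) (auto simp: sorted_wrt_append intro: less_imp_le)
  have incr: "a < b" if "subseq [a, b] L" for a b
    using L(1) that sorted_wrt_iff_subseq[of "(<)" L] by blast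
  show "good (L @ M # R)"
    unfolding good_def
  proof (intro allI impI notI)
    fix a b c d
    assume "subseq [a, b, c, d] (L @ M # R)" and f: "forbidden a b c d"
    then consider "subseq [a, b, c] L" | "subseq [a, b] L" "subseq [c, d] (M # R)"
      | "a \<in> set L" "subseq [b, c, d] (M # R)" | "subseq [a, b, c, d] (M # R)"
      using subseq4_append[of a b c d L "M # R"] by blast
    then show False
    proof cases
      case 1
      then have "a < b" "a < c" 
        using incr subseq_order.trans[OF _ 1, of "[a, b]"]
          subseq_order.trans[OF _ 1, of "[a, c]"] by simp_all
      with f show False by (auto simp: forbidden_def)
    next
      case 2
      \<comment> \<open>With \<open>a < b\<close> only 3412 is left; it puts \<open>c\<close> and
        \<open>d\<close> below \<open>a\<close>, hence below \<open>?m\<close>, so that they form an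
        ascent in \<open>R\<close>.\<close>
      then have "a < b" "a \<le> ?m" using incr subseq_set[OF 2(1)] le by auto
      with f have cd: "c < d" "d < ?m" by (auto simp: forbidden_def)
      moreover have "?m < M" using M L by simp
      ultimately have "c \<noteq> M" by simp
      with 2 have "subseq [c, d] R" by simp
      with cd low show False by blast
    next
      case 3
      show False
      proof (cases "b = M")
        case True
        with 3 have cd: "subseq [c, d] R" by simp
        with M have "c < M" "d < M" using subseq_set[OF cd] by auto
        with True f le[OF 3(1)] have "c < d" "d < ?m" by (auto simp: forbidden_def)
        with cd low show False by blast
      next
        case False
        with 3 have bcd: "subseq [b, c, d] R" by (simp add: subseq_Cons2_iff)
        have "subseq [b, d] [b, c, d]" "subseq [c, d] [b, c, d]" by auto
        with bcd have bd: "subseq [b, d] R" and cd: "subseq [c, d] R"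
          using subseq_order.trans[of "[b, d]" "[b, c, d]" R] subseq_order.trans[of "[c, d]" "[b, c, d]" R]
          by blast+
        \<comment> \<open>As \<open>a \<le> ?m\<close>, an occurrence either survives the
          replacement of \<open>a\<close> by \<open>?m\<close> or contains an ascent below
          \<open>?m\<close>, namely \<open>b d\<close> or \<open>c d\<close>. Both outcomes are
          excluded.\<close>
        have nf: "\<not> forbidden ?m b c d" using R bcd by (simp add: good_Cons_iff)
        have "d \<in> set R" using subseq_set[OF bcd] by simp
        with assms(3) last_in_set[OF L(2)] have "d \<noteq> ?m" by auto
        with f nf low[OF bd] low[OF cd] le[OF 3(1)] show False
          by (auto simp: forbidden_def)
      qed
    next
      case 4
      have "a \<noteq> M"
      proof
        assume "a = M"
        then have "subseq [b, c, d] R" using 4 by simp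
        from subseq_set[OF this] M have "b < M" "c < M" "d < M" by auto
        with f \<open>a = M\<close> show False by (auto simp: forbidden_def)
      qed
      with 4 have "subseq [a, b, c, d] R" by simp
      moreover have "good R" using R by (simp add: good_Cons_iff)
      ultimately show False using f unfolding good_def by blast
    qed
  qed
qed

section \<open>Index form of avoidance, order-preserving maps and standardisation\<close>

lemma subseq_map_iff: "subseq ys (map f xs) \<longleftrightarrow> (\<exists>zs. subseq zs xs \<and> ys = map f zs)"
  unfolding subseq_conv_nths by (metis nths_map)

lemma sorted_wrt_subseq: "subseq xs ys \<Longrightarrow> sorted_wrt P ys \<Longrightarrow> sorted_wrt P xs"
  unfolding sorted_wrt_iff_subseq[of P] by (blast intro: subseq_order.trans[of _ xs ys])

lemma good_map_iff:
  assumes "\<And>x y. x \<in> set xs \<Longrightarrow> y \<in> set xs \<Longrightarrow> f x < f y \<longleftrightarrow> x < y"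
  shows "good (map f xs) \<longleftrightarrow> good xs"
proof -
  have "forbidden (f a) (f b) (f c) (f d) \<longleftrightarrow> forbidden a b c d" if "subseq [a, b, c, d] xs" for a b c d
    using subseq_set[OF that] assms by (simp add: forbidden_def)
  moreover have "subseq [a, b, c, d] (map f xs) \<longleftrightarrow>
      (\<exists>a' b' c' d'. subseq [a', b', c', d'] xs \<and> a = f a' \<and> b = f b' \<and> c = f c' \<and> d = f d')"
    for a b c d
    unfolding subseq_map_iff by (auto simp: Cons_eq_map_conv)
  ultimately show ?thesis
    unfolding good_def by metis
qed

text \<open>An index form suits the rotation, which exchanges positions with values.\<close>

lemma good_conv_nth:
  "good xs \<longleftrightarrow> (\<forall>i j k l. i < j \<longrightarrow> j < k \<longrightarrow> k < l \<longrightarrow> l < length xs \<longrightarrow>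
     \<not> forbidden (xs ! i) (xs ! j) (xs ! k) (xs ! l))"
proof -
  have "subseq [i, j, k, l] [0..<n] \<longleftrightarrow> i < j \<and> j < k \<and> k < l \<and> l < n" for i j k l n
  proof
    assume sub: "subseq [i, j, k, l] [0..<n]"
    from sorted_wrt_subseq[OF sub, of "(<)"] subseq_set[OF sub]
    show "i < j \<and> j < k \<and> k < l \<and> l < n" by simp
  next
    assume "i < j \<and> j < k \<and> k < l \<and> l < n"
    then show "subseq [i, j, k, l] [0..<n]"
      by (intro sorted_subset_imp_subseq) auto
  qed
  then have sub: "subseq [a, b, c, d] xs \<longleftrightarrow> (\<exists>i j k l. i < j \<and> j < k \<and> k < l \<and> l < length xs \<and>
      a = xs ! i \<and> b = xs ! j \<and> c = xs ! k \<and> d = xs ! l)" for a b c d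
    using subseq_map_iff[of "[a, b, c, d]" "(!) xs" "[0..<length xs]"]
    by (auto simp: map_nth Cons_eq_map_conv) blast+
  show ?thesis
    unfolding good_def sub by blast
qed

text \<open>On a finite \<open>S\<close> this is the order isomorphism onto
  \<open>{1..card S}\<close>; \<open>Suc\<close> makes the least rank 1.\<close>

definition rank :: "nat set \<Rightarrow> nat \<Rightarrow> nat" where
  "rank S s = Suc (card {x \<in> S. x < s})"

lemma rank_less_iff:
  assumes "finite S" "s \<in> S" "t \<in> S"
  shows "rank S s < rank S t \<longleftrightarrow> s < t"
proof -
  have *: "rank S s < rank S t" if "s < t" "s \<in> S" for s t
    using that assms(1) unfolding rank_def by (auto intro!: psubset_card_mono)
  then show ?thesis
    using *[of s t] *[of t s] assms(2,3) by (metis linorder_neqE_nat not_less_iff_gr_or_eq)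
qed

lemma inj_on_rank: "finite S \<Longrightarrow> inj_on (rank S) S"
  by (metis inj_onI linorder_neqE_nat rank_less_iff less_irrefl)

lemma rank_image:
  assumes "finite S"
  shows "rank S ` S = {1..card S}"
proof (rule card_subset_eq)
  have "card {x \<in> S. x < s} < card S" if "s \<in> S" for s
    using assms that by (intro psubset_card_mono) auto
  then show "rank S ` S \<subseteq> {1..card S}"
    by (auto simp: rank_def Suc_le_eq)
  show "card (rank S ` S) = card {1..card S}"
    by (simp add: card_image inj_on_rank assms)
qed simp

text \<open>Standardisation preserves the order of the entries, hence avoidance. The predicates
  carry side conditions along, so that one bijection serves \<open>Av\<close>, \<open>Low\<close>
  and \<open>Desc\<close>.\<close>

lemma card_Av_relabel:
  assumes S: "finite S"
    and PQ: "\<And>xs. set xs = S \<Longrightarrow> P xs \<longleftrightarrow> Q (map (rank S) xs)"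
  shows "card {xs \<in> Av S. P xs} = card {xs \<in> Av {1..card S}. Q xs}"
proof (rule bij_betw_same_card)
  have good: "good (map (rank S) xs) \<longleftrightarrow> good xs" if "set xs = S" for xs
    using that S rank_less_iff by (intro good_map_iff) auto
  show "bij_betw (map (rank S)) {xs \<in> Av S. P xs} {xs \<in> Av {1..card S}. Q xs}"
    unfolding bij_betw_def
  proof (intro conjI set_eqI iffI)
    show "inj_on (map (rank S)) {xs \<in> Av S. P xs}"
      by (rule inj_on_mapI, rule inj_on_subset[OF inj_on_rank[OF S]]) (auto simp: Av_iff)
  next
    fix ys assume "ys \<in> map (rank S) ` {xs \<in> Av S. P xs}"
    then show "ys \<in> {xs \<in> Av {1..card S}. Q xs}"
      using good PQ by (auto simp: Av_iff distinct_map inj_on_rank S rank_image)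
  next
    fix ys assume ys: "ys \<in> {xs \<in> Av {1..card S}. Q xs}"
    define xs where "xs = map (inv_into S (rank S)) ys"
    have sub: "set ys \<subseteq> rank S ` S" using ys rank_image[OF S] by (auto simp: Av_iff)
    then have eq: "map (rank S) xs = ys"
      unfolding xs_def by (auto simp: f_inv_into_f subset_iff intro!: map_idI)
    have set: "set xs = S"
      using ys rank_image[OF S] inv_into_image_cancel[OF inj_on_rank[OF S] subset_refl]
      by (simp add: xs_def Av_iff)
    moreover have "distinct xs" using ys eq by (metis (no_types, lifting) Av_iff distinct_map mem_Collect_eq)
    ultimately have "xs \<in> {xs \<in> Av S. P xs}"
      using ys good[OF set] PQ[OF set] unfolding eq by (simp add: Av_iff)
    with eq show "ys \<in> map (rank S) ` {xs \<in> Av S. P xs}" by blast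
  qed
qed

lemma card_Av:
  assumes "finite S"
  shows "card (Av S) = card (Av {1..card S})"
  using card_Av_relabel[OF assms, of "\<lambda>_. True" "\<lambda>_. True"] by simp

subsection \<open>The quarter-turn symmetry\<close>

lemma sorted_wrt_filter_iff:
  "sorted_wrt P (filter Q xs) \<longleftrightarrow> sorted_wrt (\<lambda>x y. Q x \<longrightarrow> Q y \<longrightarrow> P x y) xs"
  by (induction xs) auto

text \<open>Since \<open>nth\<close> counts from 0, \<open>u\<close> is the number of entries before
  the maximum \<open>n\<close>.\<close>

definition Inc :: "nat \<Rightarrow> nat \<Rightarrow> nat list set" where
  "Inc n u = {xs \<in> Av {1..n}. u < n \<and> xs ! u = n \<and> sorted_wrt (<) (take u xs)}"

text \<open>This is what remains of \<open>L n R\<close> when \<open>L\<close> increases to its last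
  entry \<open>m\<close> and \<open>L n\<close> is contracted to \<open>m\<close>. The head is not
  below itself, so the filter concerns only the tail.\<close>

definition Low :: "nat set \<Rightarrow> nat \<Rightarrow> nat list set" where
  "Low S m = {xs \<in> Av S. hd xs = m \<and> sorted_wrt (>) (filter (\<lambda>x. x < m) xs)}"

lemma card_Low_relabel:
  assumes S: "finite S" "m \<in> S"
  shows "card (Low S m) = card (Low {1..card S} (rank S m))"
  unfolding Low_def
proof (rule card_Av_relabel[OF S(1)])
  fix xs assume xs: "set xs = S"
  then have "xs \<noteq> []" using S by auto
  have "hd xs = m \<longleftrightarrow> hd (map (rank S) xs) = rank S m"
    using \<open>xs \<noteq> []\<close> hd_in_set[OF \<open>xs \<noteq> []\<close>] xs S inj_on_eq_iff[OF inj_on_rank[OF S(1)], of "hd xs" m]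
    by (simp add: hd_map)
  moreover have "sorted_wrt (>) (filter (\<lambda>x. x < m) xs) \<longleftrightarrow>
      sorted_wrt (>) (filter (\<lambda>x. x < rank S m) (map (rank S) xs))"
    unfolding sorted_wrt_filter_iff sorted_wrt_map using xs S
    by (auto intro: sorted_wrt_mono_rel[rotated] simp: rank_less_iff)
  ultimately show "(hd xs = m \<and> sorted_wrt (>) (filter (\<lambda>x. x < m) xs)) \<longleftrightarrow>
      hd (map (rank S) xs) = rank S m \<and>
      sorted_wrt (>) (filter (\<lambda>x. x < rank S m) (map (rank S) xs))"
    by blast
qed

text \<open>The point \<open>(position p + 1, value i + 1)\<close> of the diagram goes to \<open>(i + 1, n - p)\<close>.\<close>

definition rot :: "nat \<Rightarrow> nat list \<Rightarrow> nat list" where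
  "rot n xs = map (\<lambda>i. n - inv_into {..<n} ((!) xs) (Suc i)) [0..<n]"

context
  fixes n :: nat and xs :: "nat list"
  assumes xs: "set xs = {1..n}" "distinct xs"
begin

lemma length_perm: "length xs = n"
  using distinct_card[OF xs(2)] xs(1) by simp

text \<open>Replaces \<open>inv_into\<close> by an explicit position \<open>p\<close> of the value
  \<open>i + 1\<close>; apart from the length of \<open>rot n xs\<close>, later arguments use only
  this description.\<close>

lemma rot_nth:
  assumes "i < n"
  obtains p where "p < n" "xs ! p = Suc i" "rot n xs ! i = n - p"
proof -
  have "Suc i \<in> (!) xs ` {..<n}"
    using assms xs(1) length_perm by (auto simp: set_conv_nth image_def)
  then show ?thesis
    using that[of "inv_into {..<n} ((!) xs) (Suc i)"] assms
    by (metis (no_types, lifting) add_0 diff_zero f_inv_into_f inv_into_into lessThan_iff length_upt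
        nth_map nth_upt rot_def)
qed

lemma rot_perm: "set (rot n xs) = {1..n}" "distinct (rot n xs)"
proof -
  have len: "length (rot n xs) = n" by (simp add: rot_def)
  have "rot n xs ! i \<noteq> rot n xs ! j" if "i < n" "j < n" "i \<noteq> j" for i j
    using rot_nth[OF that(1)] rot_nth[OF that(2)] that(3)
    by (metis diff_diff_cancel less_imp_le_nat nat.inject)
  then show dist: "distinct (rot n xs)" by (simp add: distinct_conv_nth len)
  have "set (rot n xs) \<subseteq> {1..n}"
  proof
    fix y assume "y \<in> set (rot n xs)"
    then obtain i where "i < n" "y = rot n xs ! i" by (auto simp: in_set_conv_nth len)
    moreover obtain p where "p < n" "rot n xs ! i = n - p"
      by (rule rot_nth[OF \<open>i < n\<close>])
    ultimately show "y \<in> {1..n}" by simp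
  qed
  then show "set (rot n xs) = {1..n}"
    using distinct_card[OF dist] len card_subset_eq[of "{1..n}" "set (rot n xs)"] by simp
qed

text \<open>The rotation sends 2143, 3412, 3142 to 3412, 2143, 3142 respectively.\<close>

lemma good_rot:
  assumes "good xs"
  shows "good (rot n xs)"
  unfolding good_conv_nth
proof (intro allI impI notI)
  fix i j k l
  assume ijkl: "i < j" "j < k" "k < l" "l < length (rot n xs)"
    and f: "forbidden (rot n xs ! i) (rot n xs ! j) (rot n xs ! k) (rot n xs ! l)"
  then have l: "i < n" "j < n" "k < n" "l < n" by (auto simp: rot_def)
  obtain p where p: "p < n" "xs ! p = Suc i" "rot n xs ! i = n - p" by (rule rot_nth[OF l(1)])
  obtain q where q: "q < n" "xs ! q = Suc j" "rot n xs ! j = n - q" by (rule rot_nth[OF l(2)])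
  obtain r where r: "r < n" "xs ! r = Suc k" "rot n xs ! k = n - r" by (rule rot_nth[OF l(3)])
  obtain s where s: "s < n" "xs ! s = Suc l" "rot n xs ! l = n - s" by (rule rot_nth[OF l(4)])
  note no = assms[unfolded good_conv_nth length_perm, rule_format]
  \<comment> \<open>The value \<open>n - p\<close> decreases as \<open>p\<close> grows, so each
    pattern of the rotated list becomes an order of the positions \<open>p\<close>,
    \<open>q\<close>, \<open>r\<close>, \<open>s\<close>. Reading \<open>xs\<close> in these orders
    gives 3412, 3142 and 2143 in turn.\<close>
  from f consider "r < s" "s < p" "p < q" | "r < p" "p < s" "s < q" | "q < p" "p < s" "s < r"
    unfolding forbidden_def p q r s using p(1) q(1) r(1) s(1) by linarith
  then show False
  proof cases
    case 1
    from no[OF this q(1)] ijkl show False by (simp add: p q r s forbidden_def)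
  next
    case 2
    from no[OF this q(1)] ijkl show False by (simp add: p q r s forbidden_def)
  next
    case 3
    from no[OF this r(1)] ijkl show False by (simp add: p q r s forbidden_def)
  qed
qed

text \<open>A first entry \<open>t + 1\<close> becomes the value \<open>n\<close> at index
  \<open>t\<close>. The smaller values supply the first \<open>t\<close> entries, and
  \<open>n - p\<close> grows exactly when the position \<open>p\<close> moves left, so decreasing
  turns into increasing.\<close>

lemma rot_mem_Inc_iff:
  assumes "good xs" "t < n"
  shows "rot n xs \<in> Inc n t \<longleftrightarrow> xs \<in> Low {1..n} (Suc t)"
proof -
  obtain p where p: "p < n" "xs ! p = Suc t" "rot n xs ! t = n - p" by (rule rot_nth[OF assms(2)])
  have "rot n xs ! t = n \<longleftrightarrow> p = 0" using p by auto
  also have "\<dots> \<longleftrightarrow> xs ! 0 = Suc t"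
    using p nth_eq_iff_index_eq[OF xs(2), of 0 p] length_perm by auto
  also have "\<dots> \<longleftrightarrow> hd xs = Suc t"
    using length_perm p(1) by (cases xs) auto
  finally have hd: "rot n xs ! t = n \<longleftrightarrow> hd xs = Suc t" .
  have "sorted_wrt (<) (take t (rot n xs)) \<longleftrightarrow>
      (\<forall>i j. i < j \<longrightarrow> j < t \<longrightarrow> rot n xs ! i < rot n xs ! j)"
    unfolding sorted_wrt_iff_nth_less using assms(2) by (simp add: rot_def)
  also have "\<dots> \<longleftrightarrow> (\<forall>p q. p < q \<longrightarrow> q < n \<longrightarrow> xs ! p < Suc t \<longrightarrow> xs ! q < Suc t \<longrightarrow> xs ! q < xs ! p)"
    (is "?l \<longleftrightarrow> ?r")
  proof
    assume l: ?l
    show ?r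
    proof (intro allI impI)
      fix p q assume pq: "p < q" "q < n" "xs ! p < Suc t" "xs ! q < Suc t"
      show "xs ! q < xs ! p"
      proof (rule ccontr)
        assume "\<not> xs ! q < xs ! p"
        moreover have "xs ! p \<noteq> xs ! q"
          using pq nth_eq_iff_index_eq[OF xs(2), of p q] length_perm by auto
        moreover have "xs ! p \<in> {1..n}" "xs ! q \<in> {1..n}"
          using pq length_perm xs(1) nth_mem[of _ xs] by auto
        then obtain i j where ij: "xs ! p = Suc i" "xs ! q = Suc j"
          by (metis atLeastAtMost_iff not0_implies_Suc not_one_le_zero)
        ultimately have "i < j" "j < t" using pq by auto
        with l have less: "rot n xs ! i < rot n xs ! j" by blast
        have "i < n" "j < n" using \<open>i < j\<close> \<open>j < t\<close> assms(2) by auto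
        obtain p' where p': "p' < n" "xs ! p' = Suc i" "rot n xs ! i = n - p'"
          by (rule rot_nth[OF \<open>i < n\<close>])
        obtain q' where q': "q' < n" "xs ! q' = Suc j" "rot n xs ! j = n - q'"
          by (rule rot_nth[OF \<open>j < n\<close>])
        have "p' = p" "q' = q"
          using p'(1,2) q'(1,2) ij pq nth_eq_iff_index_eq[OF xs(2)] length_perm
          by (metis order.strict_trans)+
        with less p' q' pq show False by simp
      qed
    qed
  next
    assume r: ?r
    show ?l
    proof (intro allI impI)
      fix i j assume ij: "i < j" "j < t"
      then have "i < n" "j < n" using assms(2) by auto
      obtain p where p: "p < n" "xs ! p = Suc i" "rot n xs ! i = n - p"
        by (rule rot_nth[OF \<open>i < n\<close>])
      obtain q where q: "q < n" "xs ! q = Suc j" "rot n xs ! j = n - q"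
        by (rule rot_nth[OF \<open>j < n\<close>])
      have "\<not> p < q" using r[rule_format, of p q] p q ij by auto
      moreover have "p \<noteq> q" using p q ij by auto
      ultimately show "rot n xs ! i < rot n xs ! j" using p q by simp
    qed
  qed
  also have "\<dots> \<longleftrightarrow> sorted_wrt (>) (filter (\<lambda>x. x < Suc t) xs)"
    unfolding sorted_wrt_filter_iff unfolding sorted_wrt_iff_nth_less length_perm by simp
  finally show ?thesis
    using hd rot_perm good_rot assms xs unfolding Inc_def Low_def by (simp add: Av_iff)
qed

end

lemma inj_on_rot: "inj_on (rot n) (Av {1..n})"
proof (rule inj_onI)
  fix xs ys assume "xs \<in> Av {1..n}" "ys \<in> Av {1..n}" and eq: "rot n xs = rot n ys"
  then have xs: "set xs = {1..n}" "distinct xs" and ys: "set ys = {1..n}" "distinct ys"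
    by (auto simp: Av_iff)
  show "xs = ys"
  proof (rule nth_equalityI)
    show "length xs = length ys" using length_perm[OF xs] length_perm[OF ys] by simp
    fix p assume "p < length xs"
    then have p: "p < n" by (simp add: length_perm[OF xs])
    then have "xs ! p \<in> {1..n}" using nth_mem[of p xs] xs(1) length_perm[OF xs] by auto
    then obtain i where i: "xs ! p = Suc i" "i < n"
      by (metis atLeastAtMost_iff not0_implies_Suc not_one_le_zero Suc_le_eq)
    obtain p' where p': "p' < n" "xs ! p' = Suc i" "rot n xs ! i = n - p'"
      by (rule rot_nth[OF xs i(2)])
    obtain q where q: "q < n" "ys ! q = Suc i" "rot n ys ! i = n - q"
      by (rule rot_nth[OF ys i(2)])
    have "p' = p"
      using p p' i(1) nth_eq_iff_index_eq[OF xs(2)] length_perm[OF xs] by metis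
    moreover have "q = p'" using eq p' q by simp
    ultimately show "xs ! p = ys ! p" using i q by simp
  qed
qed

text \<open>An injective self-map of the finite set of avoiders is onto, so no inverse rotation has
  to be constructed; \<open>rot_mem_Inc_iff\<close> then matches the two subsets.\<close>

lemma card_Low_eq_card_Inc:
  assumes "t < n"
  shows "card (Low {1..n} (Suc t)) = card (Inc n t)"
proof -
  have "rot n ` Av {1..n} \<subseteq> Av {1..n}"
    using rot_perm good_rot by (auto simp: Av_iff)
  then have surj: "rot n ` Av {1..n} = Av {1..n}"
    using inj_on_rot by (intro endo_inj_surj) auto
  have "rot n ` Low {1..n} (Suc t) = Inc n t"
  proof
    show "rot n ` Low {1..n} (Suc t) \<subseteq> Inc n t"
      using rot_mem_Inc_iff assms by (auto simp: Av_iff Low_def)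
    show "Inc n t \<subseteq> rot n ` Low {1..n} (Suc t)"
    proof
      fix ys assume ys: "ys \<in> Inc n t"
      then have "ys \<in> rot n ` Av {1..n}" unfolding surj by (simp add: Inc_def)
      then obtain xs where "xs \<in> Av {1..n}" "ys = rot n xs" by blast
      with ys rot_mem_Inc_iff[of xs n t] assms show "ys \<in> rot n ` Low {1..n} (Suc t)"
        by (auto simp: Av_iff)
    qed
  qed
  moreover have "inj_on (rot n) (Low {1..n} (Suc t))"
    using inj_on_rot by (rule inj_on_subset) (auto simp: Low_def)
  ultimately show ?thesis by (metis card_image)
qed

subsection \<open>Increasing entries before the maximum\<close>

lemma Max_set_eq_last:
  assumes "sorted_wrt (<) L" "L \<noteq> []"
  shows "Max (set L) = last L"
proof (rule Max_eqI)
  fix y assume "y \<in> set L"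
  with assms show "y \<le> last L"
    by (cases L rule: rev_cases) (auto simp: sorted_wrt_append intro: less_imp_le)
qed (use assms in auto)

lemma finite_Low [simp]: "finite (Low S m)"
  by (simp add: Low_def)

text \<open>Adds the bookkeeping of values to \<open>good_increasing_max_iff\<close>: after
  contraction the values are those below \<open>n\<close> outside \<open>L\<close>, with
  \<open>last L\<close> put back to stand for the whole of \<open>L\<close>.\<close>

lemma increasing_max_mem_Inc_iff:
  assumes L: "sorted_wrt (<) L" "L \<noteq> []" and "n > 0"
  shows "L @ n # R \<in> Inc n (length L) \<longleftrightarrow> set L \<subseteq> {1..<n} \<and>
    last L # R \<in> Low (insert (last L) ({1..<n} - set L)) (last L)"
proof -
  have last: "last L \<in> set L" using L(2) by simp
  have dist: "distinct L" using L(1) strict_sorted_iff by blast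
  have eq: "set (L @ n # R) = {1..n} \<and> distinct (L @ n # R) \<longleftrightarrow>
      set L \<subseteq> {1..<n} \<and> set (last L # R) = insert (last L) ({1..<n} - set L) \<and> distinct (last L # R)"
    (is "?l \<longleftrightarrow> ?r")
  proof
    assume l: ?l
    then have "set L \<union> set R = {1..n} - {n}" "set L \<inter> set R = {}" by auto
    moreover have "{1..n} - {n} = {1..<n}" by auto
    ultimately have "set L \<subseteq> {1..<n}" "set R = {1..<n} - set L" by blast+
    then show ?r using l last by auto
  next
    assume r: ?r
    then have "set R = insert (last L) ({1..<n} - set L) - {last L}" by fastforce
    also have "\<dots> = {1..<n} - set L" using last by blast
    finally have "set R = {1..<n} - set L" .
    moreover have "{1..n} = insert n {1..<n}" using \<open>n > 0\<close> by auto
    ultimately show ?l using r dist by auto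
  qed
  have len: "length L < n" if ?l
    using that distinct_card[of "L @ n # R"] by simp
  have good: "good (L @ n # R) \<longleftrightarrow>
      good (last L # R) \<and> sorted_wrt (>) (filter (\<lambda>x. x < last L) (last L # R))" if ?l
  proof -
    have "set L \<union> set R \<subseteq> {1..n} - {n}" using that by auto
    then have "\<forall>x\<in>set L \<union> set R. x < n" by force
    then show ?thesis
      using good_increasing_max_iff[OF L, of n R] that by simp
  qed
  have "L @ n # R \<in> Inc n (length L) \<longleftrightarrow> ?l \<and> good (L @ n # R)"
    using len L by (auto simp: Inc_def Av_iff)
  also have "\<dots> \<longleftrightarrow> ?r \<and> good (last L # R) \<and> sorted_wrt (>) (filter (\<lambda>x. x < last L) (last L # R))"
    using good eq by blast
  also have "\<dots> \<longleftrightarrow> set L \<subseteq> {1..<n} \<and> last L # R \<in> Low (insert (last L) ({1..<n} - set L)) (last L)"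
    by (simp add: Low_def Av_iff conj_assoc)
  finally show ?thesis .
qed

text \<open>An increasing run is determined by its set \<open>A\<close> of values. Its last entry
  \<open>Max A\<close> represents it in the contracted list, where \<open>tl\<close> removes this
  representative before the run is restored.\<close>

lemma bij_betw_Inc:
  assumes "u > 0" "n > 0"
  shows "bij_betw (\<lambda>(A, ys). sorted_list_of_set A @ n # tl ys)
    (SIGMA A:{A. A \<subseteq> {1..<n} \<and> card A = u}. Low (insert (Max A) ({1..<n} - A)) (Max A)) (Inc n u)"
    (is "bij_betw ?f ?D _")
proof (rule bij_betw_byWitness[where f' = "\<lambda>xs. (set (take u xs), last (take u xs) # drop (Suc u) xs)"])
  have L: "set (sorted_list_of_set A) = A \<and> length (sorted_list_of_set A) = u \<and>
      sorted_wrt (<) (sorted_list_of_set A) \<and> sorted_list_of_set A \<noteq> [] \<and>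
      last (sorted_list_of_set A) = Max A \<and> ys = Max A # tl ys"
    if "(A, ys) \<in> ?D" for A ys
  proof -
    have A: "finite A" "card A = u" using that finite_subset[of A "{1..<n}"] by auto
    then have "A \<noteq> {}" using assms by auto
    have "ys \<noteq> []" "hd ys = Max A" using that by (auto simp: Low_def Av_iff)
    then show ?thesis
      using A \<open>A \<noteq> {}\<close> Max_set_eq_last[of "sorted_list_of_set A"]
      by (cases ys) (auto simp: strict_sorted_list_of_set)
  qed
  have split: "xs = take u xs @ n # drop (Suc u) xs \<and> sorted_wrt (<) (take u xs) \<and> take u xs \<noteq> [] \<and>
      length (take u xs) = u" if "xs \<in> Inc n u" for xs
  proof -
    have "length xs = n" using that length_perm[of xs n] by (auto simp: Inc_def Av_iff)
    then show ?thesis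
      using that assms id_take_nth_drop[of u xs] by (auto simp: Inc_def)
  qed
  show "\<forall>p\<in>?D. (set (take u (?f p)), last (take u (?f p)) # drop (Suc u) (?f p)) = p"
  proof
    fix p assume "p \<in> ?D"
    then obtain A ys where "p = (A, ys)" "(A, ys) \<in> ?D" by (cases p) auto
    with L[of A ys] show "(set (take u (?f p)), last (take u (?f p)) # drop (Suc u) (?f p)) = p"
      by auto
  qed
  show "\<forall>xs\<in>Inc n u. ?f (set (take u xs), last (take u xs) # drop (Suc u) xs) = xs"
  proof
    fix xs assume "xs \<in> Inc n u"
    from split[OF this] show "?f (set (take u xs), last (take u xs) # drop (Suc u) xs) = xs"
      by (simp add: sorted_list_of_set.idem_if_sorted_distinct strict_sorted_iff)
  qed
  show "?f ` ?D \<subseteq> Inc n u"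
  proof
    fix xs assume "xs \<in> ?f ` ?D"
    then obtain A ys where Ays: "(A, ys) \<in> ?D" and xs: "xs = sorted_list_of_set A @ n # tl ys" by auto
    note L = L[OF Ays]
    show "xs \<in> Inc n u"
      using increasing_max_mem_Inc_iff[of "sorted_list_of_set A" n "tl ys"] L Ays assms(2)
      unfolding xs by auto
  qed
  show "(\<lambda>xs. (set (take u xs), last (take u xs) # drop (Suc u) xs)) ` Inc n u \<subseteq> ?D"
  proof (rule image_subsetI)
    fix xs assume xs: "xs \<in> Inc n u"
    note split = split[OF xs]
    have "card (set (take u xs)) = u"
      using split distinct_card[of "take u xs"] by (auto simp: strict_sorted_iff)
    moreover have "Max (set (take u xs)) = last (take u xs)"
      using split Max_set_eq_last by blast
    moreover have "take u xs @ n # drop (Suc u) xs \<in> Inc n (length (take u xs))"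
      using split xs by metis
    ultimately show "(set (take u xs), last (take u xs) # drop (Suc u) xs) \<in> ?D"
      using increasing_max_mem_Inc_iff[of "take u xs" n "drop (Suc u) xs"] split assms(2) by auto
  qed
qed

text \<open>Besides \<open>m\<close>, the set consists of \<open>u - 1\<close> of the
  \<open>m - 1\<close> smaller positive values.\<close>

lemma card_subsets_Max:
  assumes "0 < u" "m < n" "0 < m"
  shows "card {A. A \<subseteq> {1..<n} \<and> card A = u \<and> Max A = m} = (m - 1) choose (u - 1)"
proof -
  have "{A. A \<subseteq> {1..<n} \<and> card A = u \<and> Max A = m} =
      insert m ` {B. B \<subseteq> {1..<m} \<and> card B = u - 1}"
  proof (intro subset_antisym subsetI)
    fix A assume "A \<in> {A. A \<subseteq> {1..<n} \<and> card A = u \<and> Max A = m}"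
    then have A: "A \<subseteq> {1..<n}" "card A = u" "Max A = m" by auto
    then have "finite A" "A \<noteq> {}" using assms(1) finite_subset[OF A(1)] by auto
    then have m: "m \<in> A" "\<forall>x\<in>A. x \<le> m" using Max_in[of A] Max_ge[of A] A(3) by auto
    have "x \<in> {1..<m}" if "x \<in> A - {m}" for x
      using that m(2)[rule_format, of x] subsetD[OF A(1), of x] by simp
    then have "A - {m} \<in> {B. B \<subseteq> {1..<m} \<and> card B = u - 1}" 
      using A(2) m(1) \<open>finite A\<close> by (simp add: subset_iff)
    moreover have "A = insert m (A - {m})" using m(1) by blast
    ultimately show "A \<in> insert m ` {B. B \<subseteq> {1..<m} \<and> card B = u - 1}" by blast
  next
    fix A assume "A \<in> insert m ` {B. B \<subseteq> {1..<m} \<and> card B = u - 1}"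
    then obtain B where B: "A = insert m B" "B \<subseteq> {1..<m}" "card B = u - 1" by auto
    then have "finite B" "m \<notin> B" using finite_subset[OF B(2)] by auto
    moreover from B this have "Max A = m" by (intro Max_eqI) (auto intro: less_imp_le)
    ultimately show "A \<in> {A. A \<subseteq> {1..<n} \<and> card A = u \<and> Max A = m}"
      using B assms by auto
  qed
  moreover have "inj_on (insert m) {B. B \<subseteq> {1..<m} \<and> card B = u - 1}"
  proof (rule inj_onI)
    fix B B' assume "B \<in> {B. B \<subseteq> {1..<m} \<and> card B = u - 1}"
      "B' \<in> {B. B \<subseteq> {1..<m} \<and> card B = u - 1}" and eq: "insert m B = insert m B'"
    then have "m \<notin> B" "m \<notin> B'" by auto
    with eq show "B = B'" by (simp add: insert_ident)
  qed
  ultimately show ?thesis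
    using n_subsets[of "{1..<m}" "u - 1"] by (simp add: card_image)
qed

text \<open>Let \<open>A\<close> be the set of the \<open>u\<close> entries before the maximum. Then
  \<open>t = Max A - u\<close> values below \<open>Max A\<close> stay outside \<open>A\<close>, so
  contraction leaves \<open>v + 1\<close> entries whose head has rank \<open>t + 1\<close>. After
  standardisation, the rotation puts the maximum at index \<open>t\<close>.\<close>

lemma card_Inc_rec:
  assumes "u > 0"
  shows "card (Inc (u + v + 1) u) = (\<Sum>t\<le>v. (u + t - 1 choose t) * card (Inc (v + 1) t))"
proof -
  define n where "n = u + v + 1"
  define As where "As = {A. A \<subseteq> {1..<n} \<and> card A = u}"
  have fin: "finite As" by (auto simp: As_def)
  have A: "finite A \<and> A \<noteq> {} \<and> Max A \<in> A \<and> u \<le> Max A \<and> Max A \<le> u + v \<and>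
    card (Low (insert (Max A) ({1..<n} - A)) (Max A)) = card (Inc (v + 1) (Max A - u))"
    if "A \<in> As" for A
  proof -
    have A: "A \<subseteq> {1..<n}" "card A = u" using that by (auto simp: As_def)
    then have finA: "finite A" "A \<noteq> {}" using assms finite_subset by auto
    then have max: "Max A \<in> A" by simp
    then have lt: "1 \<le> Max A" "Max A < n" using A by auto
    \<comment> \<open>At most \<open>Max A - 1\<close> values accompany \<open>Max A\<close> in
      \<open>A\<close>; this gives \<open>u \<le> Max A\<close> and makes the subtraction
      \<open>Max A - u\<close> exact.\<close>
    have sub: "A - {Max A} \<subseteq> {1..<Max A}"
    proof
      fix x assume "x \<in> A - {Max A}"
      then have "x \<le> Max A" "x \<noteq> Max A" "x \<in> {1..<n}" using finA A by auto
      then show "x \<in> {1..<Max A}" by auto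
    qed
    then have "card (A - {Max A}) \<le> Max A - 1"
      using card_mono[of "{1..<Max A}"] by simp
    then have u: "u \<le> Max A" using A max finA lt by simp
    let ?S = "insert (Max A) ({1..<n} - A)"
    have "{x \<in> ?S. x < Max A} = {1..<Max A} - (A - {Max A})"
      using lt by auto
    then have "card {x \<in> ?S. x < Max A} = (Max A - 1) - (u - 1)"
      using card_Diff_subset[OF _ sub] finA max A by simp
    then have "rank ?S (Max A) = Suc (Max A - u)"
      unfolding rank_def using assms by simp
    moreover have "card ?S = v + 1"
      using A max finA card_Diff_subset[OF finA(1) A(1)] by (simp add: n_def)
    ultimately have "card (Low ?S (Max A)) = card (Low {1..v + 1} (Suc (Max A - u)))"
      using card_Low_relabel[of ?S "Max A"] by simp
    also have "\<dots> = card (Inc (v + 1) (Max A - u))"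
      using lt by (intro card_Low_eq_card_Inc) (auto simp: n_def)
    finally have "card (Low ?S (Max A)) = card (Inc (v + 1) (Max A - u))" .
    moreover have "Max A \<le> u + v" using lt(2) unfolding n_def by linarith
    ultimately show ?thesis using finA max u by blast
  qed
  have "card (Inc n u) = card (SIGMA A:As. Low (insert (Max A) ({1..<n} - A)) (Max A))"
    using bij_betw_same_card[OF bij_betw_Inc[OF assms, of n]] by (simp add: n_def As_def)
  also have "\<dots> = (\<Sum>A\<in>As. card (Inc (v + 1) (Max A - u)))"
    using fin A by (simp add: card_SigmaI)
  also have "\<dots> = (\<Sum>t\<le>v. \<Sum>A | A \<in> As \<and> Max A - u = t. card (Inc (v + 1) (Max A - u)))"
  proof (rule sum.group[symmetric, OF fin])
    show "(\<lambda>A. Max A - u) ` As \<subseteq> {..v}"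
    proof (rule image_subsetI)
      fix B assume "B \<in> As"
      then have "Max B \<le> u + v" using A by blast
      then show "Max B - u \<in> {..v}" unfolding atMost_iff by linarith
    qed
  qed simp
  also have "\<dots> = (\<Sum>t\<le>v. (u + t - 1 choose t) * card (Inc (v + 1) t))"
  proof (rule sum.cong[OF refl])
    fix t assume t: "t \<in> {..v}"
    have "{A. A \<in> As \<and> Max A - u = t} = {A. A \<subseteq> {1..<n} \<and> card A = u \<and> Max A = u + t}"
    proof (intro Collect_cong)
      show "B \<in> As \<and> Max B - u = t \<longleftrightarrow> B \<subseteq> {1..<n} \<and> card B = u \<and> Max B = u + t" for B
        using A[of B] by (auto simp: As_def)
    qed
    then have "card {A. A \<in> As \<and> Max A - u = t} = (u + t - 1) choose (u - 1)"
      using card_subsets_Max[of u "u + t" n] t assms by (simp add: n_def)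
    also have "\<dots> = (u + t - 1) choose t"
      using assms by (subst binomial_symmetric) auto
    finally show "(\<Sum>A | A \<in> As \<and> Max A - u = t. card (Inc (v + 1) (Max A - u))) =
        (u + t - 1 choose t) * card (Inc (v + 1) t)"
      by simp
  qed
  finally show ?thesis by (simp add: n_def)
qed

text \<open>The base case of the recurrence: a leading maximum takes part in no pattern and can be
  deleted.\<close>

lemma card_Inc_0: "card (Inc (Suc v) 0) = card (Av {1..v})"
proof -
  have "Inc (Suc v) 0 = (#) (Suc v) ` Av {1..v}"
  proof (intro subset_antisym subsetI)
    fix xs assume xs: "xs \<in> Inc (Suc v) 0"
    then obtain y ys where y: "xs = y # ys" by (cases xs) (auto simp: Inc_def Av_iff)
    with xs have *: "y = Suc v" "insert (Suc v) (set ys) = {1..Suc v}" "Suc v \<notin> set ys" "distinct ys"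
      "good (Suc v # ys)"
      by (auto simp: Inc_def Av_iff)
    then have "set ys = {1..Suc v} - {Suc v}" by blast
    also have "\<dots> = {1..v}" by auto
    finally have "set ys = {1..v}" .
    with * have "ys \<in> Av {1..v}" by (auto simp: Av_iff good_Cons_max less_Suc_eq_le)
    with * y show "xs \<in> (#) (Suc v) ` Av {1..v}" by blast
  next
    fix xs assume "xs \<in> (#) (Suc v) ` Av {1..v}"
    then show "xs \<in> Inc (Suc v) 0"
      by (auto simp: Inc_def Av_iff good_Cons_max less_Suc_eq_le)
  qed
  then show ?thesis by (simp add: card_image)
qed

lemma distinct_subseq: "subseq xs ys \<Longrightarrow> distinct ys \<Longrightarrow> distinct xs"
  by (auto simp: subseq_conv_nths)

text \<open>For \<open>{1..n}\<close> these are the avoiders that no \<open>Inc n u\<close> covers.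
  A general \<open>S\<close> is convenient since removing the entry 1 leaves
  \<open>{2..n}\<close>.\<close>

definition Desc :: "nat set \<Rightarrow> nat list set" where
  "Desc S = {xs \<in> Av S. \<not> sorted_wrt (<) (takeWhile (\<lambda>x. x \<noteq> Max S) xs)}"

lemma finite_Desc [simp]: "finite (Desc S)"
  by (simp add: Desc_def)

subsection \<open>A descent before the maximum\<close>

lemma Max_atLeastAtMost_nat: "m \<le> n \<Longrightarrow> Max {m..n} = (n :: nat)"
  by (intro Max_eqI) auto

lemma rank_Max: "finite S \<Longrightarrow> S \<noteq> {} \<Longrightarrow> rank S (Max S) = card S"
proof -
  assume S: "finite S" "S \<noteq> {}"
  have "x < Max S \<longleftrightarrow> x \<noteq> Max S" if "x \<in> S" for x
    using that S Max_ge[of S x] by linarith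
  then have "{x \<in> S. x < Max S} = S - {Max S}" by blast
  moreover have "card S > 0" using S by (simp add: card_gt_0_iff)
  ultimately show ?thesis using S by (simp add: rank_def)
qed

lemma card_Desc:
  assumes "finite S" "S \<noteq> {}"
  shows "card (Desc S) = card (Desc {1..card S})"
  unfolding Desc_def
proof (rule card_Av_relabel[OF assms(1)])
  fix xs assume xs: "set xs = S"
  have "card S > 0" using assms by (simp add: card_gt_0_iff)
  then have Max: "Max {1..card S} = rank S (Max S)"
    using rank_Max[OF assms] by (simp add: Max_atLeastAtMost_nat)
  have "takeWhile (\<lambda>x. x \<noteq> Max S) xs = takeWhile ((\<lambda>x. x \<noteq> rank S (Max S)) \<circ> rank S) xs"
    using xs assms inj_on_eq_iff[OF inj_on_rank[OF assms(1)], of _ "Max S"]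
    by (intro takeWhile_cong) auto
  then have "takeWhile (\<lambda>x. x \<noteq> rank S (Max S)) (map (rank S) xs) =
      map (rank S) (takeWhile (\<lambda>x. x \<noteq> Max S) xs)"
    unfolding takeWhile_map by simp
  moreover have "sorted_wrt (<) ys \<longleftrightarrow> sorted_wrt (<) (map (rank S) ys)" if "set ys \<subseteq> S" for ys
    unfolding sorted_wrt_map using that assms(1)
    by (auto intro: sorted_wrt_mono_rel[rotated] simp: rank_less_iff subset_iff)
  moreover have "set (takeWhile (\<lambda>x. x \<noteq> Max S) xs) \<subseteq> S"
    using xs by (auto dest: set_takeWhileD)
  ultimately show "(\<not> sorted_wrt (<) (takeWhile (\<lambda>x. x \<noteq> Max S) xs)) \<longleftrightarrow>
      \<not> sorted_wrt (<) (takeWhile (\<lambda>x. x \<noteq> Max {1..card S}) (map (rank S) xs))"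
    unfolding Max by simp
qed

text \<open>A leading 1 is harmless, so the avoiders that start with it are counted by those of
  length \<open>k\<close>. The additive form avoids subtraction of natural numbers.\<close>

lemma card_Av_hd_noteq_1:
  "card {xs \<in> Av {1..Suc k}. hd xs \<noteq> 1} + card (Av {1..k}) = card (Av {1..Suc k})"
proof -
  have "{xs \<in> Av {1..Suc k}. hd xs = 1} = (#) 1 ` Av {2..Suc k}"
  proof (intro subset_antisym subsetI)
    fix xs assume "xs \<in> {xs \<in> Av {1..Suc k}. hd xs = 1}"
    then obtain ys where ys: "xs = 1 # ys" "insert 1 (set ys) = {1..Suc k}" "1 \<notin> set ys"
      "distinct ys" "good (1 # ys)"
      by (cases xs) (auto simp: Av_iff)
    then have "set ys = {1..Suc k} - {1}" by blast
    also have "\<dots> = {2..Suc k}" by auto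
    finally have set: "set ys = {2..Suc k}" .
    then have "good ys" using ys(5) good_Cons_min[of ys 1] by simp
    with set ys show "xs \<in> (#) 1 ` Av {2..Suc k}" by (simp add: Av_iff)
  next
    fix xs assume "xs \<in> (#) 1 ` Av {2..Suc k}"
    then show "xs \<in> {xs \<in> Av {1..Suc k}. hd xs = 1}"
      by (auto simp: Av_iff good_Cons_min)
  qed
  then have "card {xs \<in> Av {1..Suc k}. hd xs = 1} = card (Av {2..Suc k})"
    by (simp add: card_image)
  also have "\<dots> = card (Av {1..k})" using card_Av[of "{2..Suc k}"] by simp
  finally have *: "card {xs \<in> Av {1..Suc k}. hd xs = 1} = card (Av {1..k})" .
  have "Av {1..Suc k} = {xs \<in> Av {1..Suc k}. hd xs \<noteq> 1} \<union> {xs \<in> Av {1..Suc k}. hd xs = 1}"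
    by blast
  then have "card (Av {1..Suc k}) =
      card ({xs \<in> Av {1..Suc k}. hd xs \<noteq> 1} \<union> {xs \<in> Av {1..Suc k}. hd xs = 1})"
    by simp
  also have "\<dots> = card {xs \<in> Av {1..Suc k}. hd xs \<noteq> 1} + card {xs \<in> Av {1..Suc k}. hd xs = 1}"
    by (rule card_Un_disjoint) auto
  finally show ?thesis using * by simp
qed

context
  fixes n :: nat
  assumes n: "n \<ge> 2"
begin

lemma Max_1n: "Max {1..n} = n"
  using n by (intro Max_atLeastAtMost_nat) auto

lemma Max_2n: "Max {2..n} = n"
  using n by (intro Max_atLeastAtMost_nat) auto

lemma insert_1_eq_iff: "insert 1 A = {1..n} \<and> 1 \<notin> A \<longleftrightarrow> A = {2..n}"
proof
  assume "insert 1 A = {1..n} \<and> 1 \<notin> A"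
  then have "A = {1..n} - {1}" by blast
  also have "\<dots> = {2..n}" by auto
  finally show "A = {2..n}" .
next
  assume "A = {2..n}"
  then show "insert 1 A = {1..n} \<and> 1 \<notin> A" using n by auto
qed

text \<open>A leading 1 creates neither a pattern nor a descent, and as \<open>n \<ge> 2\<close> it
  is not the maximum that ends the prefix.\<close>

lemma Cons_1_mem_Desc_iff: "1 # ys \<in> Desc {1..n} \<longleftrightarrow> ys \<in> Desc {2..n}"
proof -
  have "insert 1 (set ys) = {1..n} \<and> 1 \<notin> set ys \<longleftrightarrow> set ys = {2..n}"
    by (rule insert_1_eq_iff)
  moreover have "good (1 # ys) \<longleftrightarrow> good ys" if "set ys = {2..n}"
    using that by (intro good_Cons_min) auto
  ultimately have "1 # ys \<in> Av {1..n} \<longleftrightarrow> ys \<in> Av {2..n}"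
    by (auto simp: Av_iff)
  moreover have "sorted_wrt (<) (takeWhile (\<lambda>x. x \<noteq> n) (1 # ys)) \<longleftrightarrow>
      sorted_wrt (<) (takeWhile (\<lambda>x. x \<noteq> n) ys)" if "set ys = {2..n}"
    using that n set_takeWhileD[of _ "\<lambda>x. x \<noteq> n" ys] by fastforce
  ultimately show ?thesis
    unfolding Desc_def Max_1n Max_2n by (auto simp: Av_iff)
qed

text \<open>A final 1 creates no pattern and lies after the maximum, so the prefix that must contain
  a descent is unchanged.\<close>

lemma snoc_1_mem_Desc_iff: "ys @ [1] \<in> Desc {1..n} \<longleftrightarrow> ys \<in> Desc {2..n}"
proof -
  have "insert 1 (set ys) = {1..n} \<and> 1 \<notin> set ys \<longleftrightarrow> set ys = {2..n}"
    by (rule insert_1_eq_iff)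
  moreover have "good (ys @ [1]) \<longleftrightarrow> good ys" if "set ys = {2..n}"
    using that by (intro good_snoc_min) auto
  ultimately have "ys @ [1] \<in> Av {1..n} \<longleftrightarrow> ys \<in> Av {2..n}"
    by (auto simp: Av_iff)
  moreover have "takeWhile (\<lambda>x. x \<noteq> n) (ys @ [1]) = takeWhile (\<lambda>x. x \<noteq> n) ys" if "set ys = {2..n}"
    using that n by (intro takeWhile_append1[of n]) auto
  ultimately show ?thesis
    unfolding Desc_def Max_1n Max_2n by (auto simp: Av_iff)
qed

text \<open>The entry 1 cannot stand after \<open>n\<close>, so it stands before \<open>n\<close>
  without being first and ends an inversion there. Every entry after \<open>n\<close> would then
  have to be smaller than 1.\<close>

lemma Desc_cases:
  assumes xs: "xs \<in> Desc {1..n}" and "hd xs \<noteq> 1" "last xs \<noteq> 1"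
  shows "\<exists>zs \<in> Av {1..<n}. xs = zs @ [n] \<and> hd zs \<noteq> 1"
proof -
  have set: "set xs = {1..n}" "distinct xs" and "good xs" using xs by (auto simp: Desc_def Av_iff)
  note good = \<open>good xs\<close>[unfolded good_def, rule_format]
  have "n \<in> set xs" using set n by simp
  then obtain L R where LR: "xs = L @ n # R" "n \<notin> set L" by (meson split_list_first)
  have "takeWhile (\<lambda>x. x \<noteq> n) xs = L"
    unfolding LR using LR(2) by (subst takeWhile_append2) auto
  with xs have "\<not> sorted_wrt (<) L" unfolding Desc_def Max_1n by simp
  then obtain b a where ba: "subseq [b, a] L" "\<not> b < a"
    unfolding sorted_wrt_iff_subseq[of "(<)" L] by blast
  have "distinct [b, a]"
    using ba(1) set(2) LR distinct_subseq[of "[b, a]" L] by simp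
  with ba have "a < b" by simp
  have ab: "a \<in> set L" "b \<in> set L" using subseq_set[OF ba(1)] by auto
  have lt: "x < n" if "x \<in> set L \<union> set R" for x
  proof -
    have "x \<in> {1..n}" "x \<noteq> n" using that set LR by auto
    then show ?thesis by simp
  qed
  have disj: "x \<noteq> y" if "x \<in> set L" "y \<in> set R" for x y
    using that set LR by auto
  have sub: "subseq (ys @ [n] @ zs) xs" if "subseq ys L" "subseq zs R" for ys zs
    unfolding LR using that by (intro list_emb_append_mono) auto
  \<comment> \<open>After the inversion \<open>b' a'\<close> and the maximum, an entry
    \<open>r\<close> above \<open>b'\<close> gives 2143, and one between \<open>a'\<close> and
    \<open>b'\<close> gives 3142.\<close>
  have right_le: "r < a'" if "subseq [b', a'] L" "a' < b'" "r \<in> set R" for r a' b'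
  proof -
    have "subseq [b', a', n, r] xs"
      using sub[OF that(1), of "[r]"] that(3) by (simp add: subseq_singleton_left)
    then have "\<not> forbidden b' a' n r" by (rule good)
    moreover have "a' \<in> set L" "b' \<in> set L" using subseq_set[OF that(1)] by auto
    then have "r \<noteq> a'" "r \<noteq> b'" "r < n" "b' < n"
      using disj[of _ r] lt that(3) by auto
    ultimately show ?thesis using that(2) by (auto simp: forbidden_def)
  qed
  have "1 \<in> set xs" using set n by simp
  \<comment> \<open>Some \<open>r\<close> would follow 1, and \<open>right_le\<close> puts it below
    \<open>a\<close>, hence below \<open>b\<close>; then \<open>b n 1 r\<close> is a 3412.\<close>
  moreover have "1 \<notin> set R"
  proof
    assume "1 \<in> set R"
    then obtain R1 R2 where R: "R = R1 @ 1 # R2" by (meson split_list)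
    with LR assms(3) have "R2 \<noteq> []" by auto
    then obtain r where r: "r \<in> set R2" by (cases R2) auto
    then have "subseq [1, r] R"
      unfolding R by (simp add: subseq_drop_many subseq_singleton_left)
    then have "subseq [b, n, 1, r] xs"
      using sub[of "[b]" "[1, r]"] ab by (simp add: subseq_singleton_left)
    then have "\<not> forbidden b n 1 r" by (rule good)
    moreover have "r < a" using right_le[OF ba(1) \<open>a < b\<close>] r R by simp
    moreover have "r \<in> {1..n}" "r \<noteq> 1" using r R LR set by auto
    ultimately show False using \<open>a < b\<close> lt[of b] ab by (auto simp: forbidden_def)
  qed
  ultimately have "1 \<in> set L" using LR n by auto
  then obtain h L' where L: "L = h # L'" by (cases L) auto
  with LR assms(2) have h: "h \<noteq> 1" "1 \<in> set L'" using \<open>1 \<in> set L\<close> by auto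
  have "h \<in> {1..n}" using LR L set by auto
  with h have "1 < h" by simp
  have "subseq [h, 1] L" using h by (simp add: L subseq_singleton_left)
  have "R = []"
  proof (rule ccontr)
    assume "R \<noteq> []"
    then obtain r where r: "r \<in> set R" by (cases R) auto
    from right_le[OF \<open>subseq [h, 1] L\<close> \<open>1 < h\<close> r] have "r = 0" by simp
    with r LR set show False by auto
  qed
  then have "insert n (set L) = {1..n}" "good (L @ [n])" "distinct L"
    using LR set \<open>good xs\<close> by auto
  then have "set L = {1..n} - {n}" using LR(2) by blast
  also have "\<dots> = {1..<n}" by auto
  finally have "set L = {1..<n}" .
  then have "L \<in> Av {1..<n}"
    using \<open>good (L @ [n])\<close> \<open>distinct L\<close> good_snoc_max[of L n] by (simp add: Av_iff)
  with \<open>R = []\<close> LR L h show ?thesis by auto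
qed

lemma snoc_n_mem_Desc:
  assumes "zs \<in> Av {1..<n}" "hd zs \<noteq> 1"
  shows "zs @ [n] \<in> Desc {1..n}"
proof -
  have zs: "set zs = {1..<n}" "distinct zs" "good zs" using assms by (auto simp: Av_iff)
  have "insert n {1..<n} = {1..n}" using n by auto
  with zs have "zs @ [n] \<in> Av {1..n}" by (simp add: Av_iff good_snoc_max)
  moreover have "takeWhile (\<lambda>x. x \<noteq> n) (zs @ [n]) = zs" using zs by (subst takeWhile_append2) auto
  \<comment> \<open>The entry 1 occurs in \<open>zs\<close>, so increasing order would bring it to
    the front.\<close>
  moreover have "\<not> sorted_wrt (<) zs"
  proof
    assume "sorted_wrt (<) zs"
    moreover have "1 \<in> set zs" using zs n by simp
    ultimately have "hd zs \<le> 1" by (cases zs) auto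
    moreover have "zs \<noteq> []" using \<open>1 \<in> set zs\<close> by auto
    then have "hd zs \<in> {1..<n}" using hd_in_set[of zs] zs(1) by simp
    ultimately show False using assms(2) by simp
  qed
  ultimately show ?thesis unfolding Desc_def Max_1n by simp
qed

lemma Desc_eq:
  "Desc {1..n} = (#) 1 ` Desc {2..n} \<union> (\<lambda>ys. ys @ [1]) ` Desc {2..n} \<union>
     (\<lambda>zs. zs @ [n]) ` {zs \<in> Av {1..<n}. hd zs \<noteq> 1}"
proof (intro subset_antisym subsetI)
  fix xs assume xs: "xs \<in> Desc {1..n}"
  then have "xs \<noteq> []" using n by (auto simp: Desc_def)
  then have eq: "xs = hd xs # tl xs" "xs = butlast xs @ [last xs]" by auto
  consider "hd xs = 1" | "last xs = 1" | "hd xs \<noteq> 1" "last xs \<noteq> 1" by blast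
  then show "xs \<in> (#) 1 ` Desc {2..n} \<union> (\<lambda>ys. ys @ [1]) ` Desc {2..n} \<union>
     (\<lambda>zs. zs @ [n]) ` {zs \<in> Av {1..<n}. hd zs \<noteq> 1}"
  proof cases
    case 1
    with eq(1) xs show ?thesis using Cons_1_mem_Desc_iff[of "tl xs"] by auto
  next
    case 2
    with eq(2) have "xs = butlast xs @ [1]" by simp
    with xs snoc_1_mem_Desc_iff[of "butlast xs"] have "butlast xs \<in> Desc {2..n}" by simp
    with \<open>xs = butlast xs @ [1]\<close> show ?thesis by blast
  next
    case 3
    from Desc_cases[OF xs this] show ?thesis by auto
  qed
next
  fix xs assume "xs \<in> (#) 1 ` Desc {2..n} \<union> (\<lambda>ys. ys @ [1]) ` Desc {2..n} \<union>
     (\<lambda>zs. zs @ [n]) ` {zs \<in> Av {1..<n}. hd zs \<noteq> 1}"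
  then show "xs \<in> Desc {1..n}"
    using Cons_1_mem_Desc_iff snoc_1_mem_Desc_iff snoc_n_mem_Desc by auto
qed

end

text \<open>Coefficient form of the equation for \<open>B\<close>. Removing a first or a last 1
  leaves a member of \<open>Desc\<close>, whence the factor 2; in the remaining case the maximum is
  last, and removing it leaves an avoider that does not start with 1.\<close>

lemma card_Desc_rec:
  "card (Desc {1..Suc (Suc k)}) + card (Av {1..k}) = 2 * card (Desc {1..Suc k}) + card (Av {1..Suc k})"
proof -
  let ?n = "Suc (Suc k)"
  let ?A = "(#) 1 ` Desc {2..?n}" and ?B = "(\<lambda>ys. ys @ [1]) ` Desc {2..?n}"
    and ?C = "(\<lambda>zs. zs @ [?n]) ` {zs \<in> Av {1..<?n}. hd zs \<noteq> 1}"
  have 1: "ys \<noteq> [] \<and> 1 \<notin> set ys" if "ys \<in> Desc {2..?n}" for ys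
    using that by (auto simp: Desc_def Av_iff)
  have 2: "zs \<noteq> []" if "zs \<in> Av {1..<?n}" for zs
    using that by (auto simp: Av_iff)
  have "?A \<inter> ?B = {}"
  proof -
    have "1 # ys \<noteq> zs @ [1]" if "ys \<in> Desc {2..?n}" "zs \<in> Desc {2..?n}" for ys zs
      using 1[OF that(1)] 1[OF that(2)] by (cases zs) auto
    then show ?thesis by blast
  qed
  moreover have "(?A \<union> ?B) \<inter> ?C = {}"
  proof -
    have "1 # ys \<noteq> zs @ [?n]" if "zs \<in> Av {1..<?n}" "hd zs \<noteq> 1" for ys zs
      using 2[OF that(1)] that(2) by (cases zs) auto
    moreover have "ys @ [1] \<noteq> zs @ [?n]" for ys zs by simp
    ultimately show ?thesis by blast
  qed
  moreover have "card ?A = card (Desc {2..?n})" "card ?B = card (Desc {2..?n})"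
    "card ?C = card {zs \<in> Av {1..Suc k}. hd zs \<noteq> 1}"
    by (auto intro!: card_image inj_onI simp flip: atLeastLessThanSuc_atLeastAtMost)
  moreover have "card (Desc {1..?n}) = card (?A \<union> ?B \<union> ?C)" using Desc_eq[of ?n] by simp
  ultimately have "card (Desc {1..?n}) =
      2 * card (Desc {2..?n}) + card {zs \<in> Av {1..Suc k}. hd zs \<noteq> 1}"
    by (simp add: card_Un_disjoint)
  moreover have "card (Desc {2..?n}) = card (Desc {1..Suc k})"
    using card_Desc[of "{2..?n}"] by simp
  ultimately show ?thesis using card_Av_hd_noteq_1[of k] by simp
qed

section \<open>Splitting the avoiders by the entries before the maximum\<close>

lemma Desc_1: "Desc {1..1} = {}"
proof -
  have "takeWhile (\<lambda>x. x \<noteq> 1) xs = []" if "set xs = {1::nat}" for xs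
    using that by (cases xs) auto
  then show ?thesis by (auto simp: Desc_def Av_iff)
qed

lemma card_Av_split:
  assumes "n > 0"
  shows "card (Av {1..n}) = card (Desc {1..n}) + (\<Sum>u<n. card (Inc n u))"
proof -
  have Max: "Max {1..n} = n" using assms by (intro Max_atLeastAtMost_nat) auto
  have tw: "takeWhile (\<lambda>x. x \<noteq> n) xs = take u xs" if "xs \<in> Inc n u" for xs u
  proof -
    have xs: "set xs = {1..n}" "distinct xs" and u: "u < n" "xs ! u = n"
      using that by (auto simp: Inc_def Av_iff)
    have len: "length xs = n" by (rule length_perm[OF xs])
    have eq: "xs = take u xs @ n # drop (Suc u) xs"
      using id_take_nth_drop[of u xs] u len by simp
    then have "n \<notin> set (take u xs)" using xs(2) by (metis distinct.simps(2) distinct_append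
      disjoint_insert(1) list.simps(15))
    then show ?thesis by (subst eq, subst takeWhile_append2) auto
  qed
  have eq: "Av {1..n} = Desc {1..n} \<union> (\<Union>u\<in>{..<n}. Inc n u)"
  proof (intro subset_antisym subsetI)
    fix xs assume xs: "xs \<in> Av {1..n}"
    show "xs \<in> Desc {1..n} \<union> (\<Union>u\<in>{..<n}. Inc n u)"
    proof (cases "sorted_wrt (<) (takeWhile (\<lambda>x. x \<noteq> n) xs)")
      case False
      with xs have "xs \<in> Desc {1..n}" unfolding Desc_def Max by blast
      then show ?thesis by blast
    next
      case True
      let ?u = "length (takeWhile (\<lambda>x. x \<noteq> n) xs)"
      have "n \<in> set xs" "length xs = n"
        using xs assms length_perm[of xs n] by (auto simp: Av_iff)
      then have "takeWhile (\<lambda>x. x \<noteq> n) xs \<noteq> xs" unfolding takeWhile_eq_all_conv by blast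
      then have "?u < n"
        using takeWhile_eq_take[of "\<lambda>x. x \<noteq> n" xs] \<open>length xs = n\<close>
        by (metis not_le take_all_iff)
      moreover have "xs ! ?u = n"
        using nth_length_takeWhile[of "\<lambda>x. x \<noteq> n" xs] \<open>length xs = n\<close> \<open>?u < n\<close> by simp
      moreover have "take ?u xs = takeWhile (\<lambda>x. x \<noteq> n) xs" by (rule takeWhile_eq_take[symmetric])
      ultimately have "xs \<in> Inc n ?u" using xs True unfolding Inc_def by simp
      with \<open>?u < n\<close> show ?thesis by blast
    qed
  next
    fix xs assume "xs \<in> Desc {1..n} \<union> (\<Union>u\<in>{..<n}. Inc n u)"
    then show "xs \<in> Av {1..n}" by (auto simp: Desc_def Inc_def)
  qed
  have fin: "finite (Inc n u)" for u by (simp add: Inc_def)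
  have disj: "Inc n u \<inter> Inc n v = {}" if "u \<noteq> v" for u v
  proof (rule ccontr)
    assume "Inc n u \<inter> Inc n v \<noteq> {}"
    then obtain xs where xs: "xs \<in> Inc n u" "xs \<in> Inc n v" by blast
    then have "distinct xs" "length xs = n" "u < n" "v < n" "xs ! u = xs ! v"
      using length_perm[of xs n] by (auto simp: Inc_def Av_iff)
    with that show False by (simp add: nth_eq_iff_index_eq)
  qed
  have "card (Av {1..n}) = card (Desc {1..n}) + card (\<Union>u\<in>{..<n}. Inc n u)"
    unfolding eq
  proof (rule card_Un_disjoint)
    have "xs \<notin> Desc {1..n}" if "xs \<in> Inc n u" for xs u
      using tw[OF that] that unfolding Desc_def Max Inc_def by simp
    then show "Desc {1..n} \<inter> (\<Union>u\<in>{..<n}. Inc n u) = {}" by blast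
  qed (simp_all add: fin)
  also have "card (\<Union>u\<in>{..<n}. Inc n u) = (\<Sum>u<n. card (Inc n u))"
    using fin disj by (intro card_UN_disjoint) auto
  finally show ?thesis .
qed

subsection \<open>Generating functions\<close>

unbundle fps_syntax

text \<open>Squaring \<open>2xC = 1 - s\<close>, where \<open>s^2 = 1 - 4x\<close>, yields the
  quadratic equation after cancelling \<open>4x\<close>.\<close>

lemma catalan_gf_eq: "catalan_gf = 1 + fps_X * catalan_gf ^ 2"
proof -
  define s where "s = fps_radical root 2 (1 - 4 * fps_X :: real fps)"
  have s2: "s ^ 2 = 1 - 4 * fps_X"
    using power_radical[of "1 - 4 * fps_X :: real fps" root 1] by (simp add: s_def numeral_2_eq_2)
  have s0: "s $ 0 = 1" by (simp add: s_def)
  \<comment> \<open>The division that defines \<open>catalan_gf\<close> is exact because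
    \<open>1 - s\<close> has constant coefficient 0.\<close>
  have "2 * fps_X dvd 1 - s"
  proof (cases "1 - s = 0")
    case False
    have "subdegree (2 * fps_X :: real fps) = 1"
      by (intro subdegreeI) (auto simp: numeral_fps_const)
    moreover have "subdegree (1 - s) \<ge> 1"
      using False s0 by (intro subdegree_geI) auto
    ultimately show ?thesis
      using False by (subst fps_dvd_iff) auto
  qed simp
  then have C: "2 * fps_X * catalan_gf = 1 - s"
    unfolding catalan_gf_def s_def by simp
  have "4 * fps_X * (fps_X * catalan_gf ^ 2) = (2 * fps_X * catalan_gf) ^ 2"
    by (simp add: power2_eq_square algebra_simps)
  also have "\<dots> = 1 - 2 * s + s ^ 2"
    unfolding C by (simp add: power2_eq_square algebra_simps)
  also have "\<dots> = 2 * (1 - s) - 4 * fps_X"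
    unfolding s2 by (simp add: algebra_simps)
  also have "\<dots> = 4 * fps_X * (catalan_gf - 1)"
    unfolding C[symmetric] by (simp add: algebra_simps)
  finally have "fps_X * catalan_gf ^ 2 = catalan_gf - 1"
    by simp
  then show ?thesis by (simp add: algebra_simps)
qed

lemma fps_mult_compose_nth:
  fixes a b c :: "'a :: comm_ring_1 fps"
  assumes "c $ 0 = 0"
  shows "(a * (b oo c)) $ n = (\<Sum>i\<le>n. b $ i * (a * c ^ i) $ n)"
proof -
  have "(a * (b oo c)) $ n = (\<Sum>j=0..n. a $ j * (\<Sum>i=0..n. b $ i * (c ^ i) $ (n - j)))"
    unfolding fps_mult_nth fps_compose_nth
  proof (rule sum.cong[OF refl])
    fix j assume "j \<in> {0..n}"
    \<comment> \<open>As \<open>c ^ i\<close> vanishes below degree \<open>i\<close>, the range can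
      be extended to a bound that does not depend on \<open>j\<close>; the two sums can then be
      swapped.\<close>
    have "(\<Sum>i = 0..n - j. b $ i * (c ^ i) $ (n - j)) = (\<Sum>i=0..n. b $ i * (c ^ i) $ (n - j))"
      using assms by (intro sum.mono_neutral_left) (auto simp: startsby_zero_power_prefix)
    then show "a $ j * (\<Sum>i = 0..n - j. b $ i * (c ^ i) $ (n - j)) =
        a $ j * (\<Sum>i=0..n. b $ i * (c ^ i) $ (n - j))"
      by simp
  qed
  also have "\<dots> = (\<Sum>i=0..n. \<Sum>j=0..n. b $ i * (a $ j * (c ^ i) $ (n - j)))"
    by (subst sum.swap) (simp add: sum_distrib_left algebra_simps)
  also have "\<dots> = (\<Sum>i\<le>n. b $ i * (a * c ^ i) $ n)"
    by (simp add: fps_mult_nth sum_distrib_left atMost_atLeast0)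
  finally show ?thesis .
qed

text \<open>The series is the expansion of \<open>(1 - x)^(-(u+1))\<close>. In the induction,
  multiplying by \<open>1 - x\<close> lowers the exponent by Pascal's rule.\<close>

lemma fps_neg_binomial_mult:
  "Abs_fps (\<lambda>t. of_nat (Suc u + t - 1 choose t)) * (1 - fps_X) ^ Suc u = (1 :: real fps)"
proof (induction u)
  case (Suc u)
  let ?B = "\<lambda>u. Abs_fps (\<lambda>t. of_nat (Suc u + t - 1 choose t)) :: real fps"
  have "?B (Suc u) * (1 - fps_X) = ?B u"
  proof (rule fps_ext)
    fix t show "(?B (Suc u) * (1 - fps_X)) $ t = ?B u $ t"
      by (cases t) (simp_all add: algebra_simps)
  qed
  then have "?B (Suc u) * (1 - fps_X) ^ Suc (Suc u) = ?B u * (1 - fps_X) ^ Suc u"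
    unfolding power_Suc[of _ "Suc u"] mult.assoc[symmetric] by (simp only:)
  with Suc show ?case by simp
next
  case 0
  show ?case by (rule fps_ext) (auto simp: algebra_simps fps_eq_iff)
qed

lemma catalan_gf_inverse: "(1 - fps_X * catalan_gf) * catalan_gf = 1"
  using catalan_gf_eq by (simp add: algebra_simps power2_eq_square)

text \<open>Substituting \<open>xC\<close> for \<open>x\<close> in the expansion of
  \<open>(1 - x)^(-u)\<close> gives \<open>(1 - xC)^(-u) = C^u\<close>. The coefficients of
  \<open>A C^u\<close> thus obey the recurrence of \<open>card_Inc_rec\<close>.\<close>

lemma mult_catalan_power_nth:
  fixes A :: "real fps"
  assumes "u > 0"
  shows "(A * catalan_gf ^ u) $ v = (\<Sum>t\<le>v. real (u + t - 1 choose t) * (A * catalan_gf ^ t) $ (v - t))"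
proof -
  obtain w where w: "u = Suc w" using assms by (cases u) auto
  define B where "B = (Abs_fps (\<lambda>t. of_nat (u + t - 1 choose t)) :: real fps)"
  let ?D = "fps_X * catalan_gf"
  have "(B * (1 - fps_X) ^ u) oo ?D = 1"
    using fps_neg_binomial_mult[of w] by (simp add: B_def w)
  then have "(B oo ?D) * (1 - ?D) ^ u = 1"
    by (simp add: fps_compose_mult_distrib fps_compose_sub_distrib flip: fps_compose_power)
  then have "(B oo ?D) * ((1 - ?D) * catalan_gf) ^ u = catalan_gf ^ u"
    by (simp add: power_mult_distrib mult.assoc[symmetric])
  then have "B oo ?D = catalan_gf ^ u" by (simp add: catalan_gf_inverse)
  then have "(A * catalan_gf ^ u) $ v = (\<Sum>t\<le>v. B $ t * (A * ?D ^ t) $ v)"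
    using fps_mult_compose_nth[of ?D A B v] by simp
  also have "\<dots> = (\<Sum>t\<le>v. real (u + t - 1 choose t) * (A * catalan_gf ^ t) $ (v - t))"
  proof (rule sum.cong[OF refl])
    fix t assume "t \<in> {..v}"
    have eq: "A * ?D ^ t = fps_X ^ t * (A * catalan_gf ^ t)"
      by (simp only: power_mult_distrib mult_ac)
    from \<open>t \<in> {..v}\<close> show "B $ t * (A * ?D ^ t) $ v =
        real (u + t - 1 choose t) * (A * catalan_gf ^ t) $ (v - t)"
      unfolding eq fps_X_power_mult_nth B_def by simp
  qed
  finally show ?thesis .
qed

text \<open>Both sides satisfy the same recurrence. Here \<open>v\<close> counts the entries after
  the maximum; the term for \<open>t\<close> has \<open>v - t\<close> of them, so strong induction
  on \<open>v\<close> covers \<open>t > 0\<close>, and \<open>card_Inc_0\<close> covers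
  \<open>t = 0\<close>.\<close>

lemma card_Inc_eq:
  "real (card (Inc (Suc (u + v)) u)) =
     (Abs_fps (\<lambda>n. real (card (Av {1..n}))) * catalan_gf ^ u) $ v"
proof (induction v arbitrary: u rule: less_induct)
  case (less v)
  let ?A = "Abs_fps (\<lambda>n. real (card (Av {1..n})))"
  have *: "real (card (Inc (Suc v) t)) = (?A * catalan_gf ^ t) $ (v - t)" if "t \<le> v" for t
  proof (cases "t = 0")
    case True
    then show ?thesis by (simp add: card_Inc_0)
  next
    case False
    with that less.IH[of "v - t" t] show ?thesis by simp
  qed
  show ?case
  proof (cases "u = 0")
    case True
    then show ?thesis by (simp add: card_Inc_0)
  next
    case False
    then have "real (card (Inc (Suc (u + v)) u)) =
        (\<Sum>t\<le>v. real (u + t - 1 choose t) * real (card (Inc (Suc v) t)))"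
      using card_Inc_rec[of u v] by simp
    also have "\<dots> = (?A * catalan_gf ^ u) $ v"
      using * False by (simp add: mult_catalan_power_nth)
    finally show ?thesis .
  qed
qed

text \<open>Eliminates \<open>B\<close> from the two functional equations and then uses the
  quadratic equation for \<open>C\<close>.\<close>

lemma card_Av_rec:
  defines "A \<equiv> Abs_fps (\<lambda>n. real (card (Av {1..n})))"
  shows "A * (1 - 2 * fps_X - fps_X * (1 - fps_X) * catalan_gf) = (1 - 3 * fps_X) * catalan_gf"
proof -
  let ?C = catalan_gf
  define B where "B = Abs_fps (\<lambda>n. real (card (Desc {1..n})))"
  have Av_0: "Av {1..0} = {[]}" by (auto simp: Av_iff good_def)
  have Desc_0: "Desc {1..0} = {}" using Av_0 by (auto simp: Desc_def)
  have A_eq: "A = 1 + B + fps_X * (A * ?C)"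
  proof (rule fps_ext)
    fix n
    show "A $ n = (1 + B + fps_X * (A * ?C)) $ n"
    proof (cases n)
      case 0
      then show ?thesis using Av_0 Desc_0 by (simp add: A_def B_def)
    next
      case (Suc m)
      have "(\<Sum>u<Suc m. real (card (Inc (Suc m) u))) = (\<Sum>u\<le>m. (A * ?C ^ u) $ (m - u))"
        unfolding lessThan_Suc_atMost
      proof (rule sum.cong[OF refl])
        fix u assume "u \<in> {..m}"
        then show "real (card (Inc (Suc m) u)) = (A * ?C ^ u) $ (m - u)"
          using card_Inc_eq[of u "m - u"] by (simp add: A_def)
      qed
      \<comment> \<open>This is the recurrence for the powers of \<open>C\<close> at
        \<open>u = 1\<close>, where every binomial coefficient is
        \<open>t choose t = 1\<close>.\<close>
      also have "\<dots> = (A * ?C) $ m"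
        using mult_catalan_power_nth[of 1 A m] by simp
      finally show ?thesis
        using card_Av_split[of "Suc m"] Suc by (simp add: A_def B_def flip: of_nat_sum)
    qed
  qed
  have B_eq: "B * (1 - 2 * fps_X) = fps_X * (A - 1 - fps_X * A)"
  proof (rule fps_ext)
    fix n
    have "B * (1 - 2 * fps_X) = B - 2 * (fps_X * B)" by (simp add: algebra_simps)
    then have B: "(B * (1 - 2 * fps_X)) $ n = B $ n - 2 * (if n = 0 then 0 else B $ (n - 1))"
      by (simp add: numeral_fps_const)
    \<comment> \<open>The recurrence for \<open>Desc\<close> starts at length 2, so coefficients 0
      and 1 are checked separately.\<close>
    consider "n = 0" | "n = 1" | k where "n = Suc (Suc k)"
      by (metis One_nat_def not0_implies_Suc)
    then show "(B * (1 - 2 * fps_X)) $ n = (fps_X * (A - 1 - fps_X * A)) $ n"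
    proof cases
      case 1
      then show ?thesis unfolding B using Desc_0 by (simp add: B_def)
    next
      case 2
      then show ?thesis unfolding B using Desc_0 Desc_1 Av_0 by (simp add: A_def B_def)
    next
      case (3 k)
      have "real (card (Desc {1..Suc (Suc k)})) + real (card (Av {1..k})) =
          2 * real (card (Desc {1..Suc k})) + real (card (Av {1..Suc k}))"
        using arg_cong[OF card_Desc_rec[of k], of real] by simp
      with 3 show ?thesis unfolding B by (simp add: A_def B_def)
    qed
  qed
  have C: "fps_X * ?C * ?C = ?C - 1"
    using catalan_gf_eq by (simp add: power2_eq_square algebra_simps)
  have "A * (1 - 2 * fps_X) = (1 + B + fps_X * (A * ?C)) * (1 - 2 * fps_X)"
    using A_eq by simp
  also have "\<dots> = (1 - 2 * fps_X) + fps_X * (A - 1 - fps_X * A) + fps_X * A * ?C * (1 - 2 * fps_X)"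
    using B_eq by (simp add: algebra_simps)
  finally have "A * (1 - 3 * fps_X + fps_X ^ 2) - A * (1 - 2 * fps_X) * (fps_X * ?C) = 1 - 3 * fps_X"
    by (simp add: algebra_simps power2_eq_square)
  \<comment> \<open>Multiplying by \<open>C\<close> makes \<open>xC^2 = C - 1\<close> applicable,
    which turns the factor of \<open>A\<close> into the desired denominator.\<close>
  then have "(A * (1 - 3 * fps_X + fps_X ^ 2) - A * (1 - 2 * fps_X) * (fps_X * ?C)) * ?C =
      (1 - 3 * fps_X) * ?C"
    by simp
  also have "(A * (1 - 3 * fps_X + fps_X ^ 2) - A * (1 - 2 * fps_X) * (fps_X * ?C)) * ?C =
      A * (1 - 3 * fps_X + fps_X ^ 2) * ?C - A * (1 - 2 * fps_X) * (fps_X * ?C * ?C)"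
    by (simp add: algebra_simps)
  also have "\<dots> = A * (1 - 2 * fps_X - fps_X * (1 - fps_X) * ?C)"
    unfolding C by (simp add: algebra_simps power2_eq_square)
  finally show ?thesis .
qed

theorem theorem3p33:
  shows "avoiding_gf {[2, 1, 4, 3], [3, 1, 4, 2], [3, 4, 1, 2]} =
    ((1 - 3 * fps_X) * catalan_gf) / (1 - 2 * fps_X - fps_X * (1 - fps_X) * catalan_gf)"
proof -
  let ?D = "1 - 2 * fps_X - fps_X * (1 - fps_X) * catalan_gf"
  \<comment> \<open>The divisor has constant coefficient 1, so it is nonzero and cancels once the
    numerator is written as the counting series times \<open>?D\<close>.\<close>
  have "?D $ 0 \<noteq> 0" by (simp add: mult.assoc)
  then have "?D \<noteq> 0" by (metis fps_zero_nth)
  then show ?thesis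
    unfolding avoiding_gf_def Sn_avoiding_eq_Av card_Av_rec[symmetric] by simp
qed

end
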